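(* Let $c>0$ and consider the convex extended logistic loss function $f_{\alpha,\beta,c}(\theta)=\ln_{2-\alpha,c}\big(c+\exp_{2-\beta,c}(\theta)\big)$ with $\mathrm{dom}\,f_{\alpha,\beta,c}=\mathrm{dom}(\exp_{2-\beta,c})$. Then, under any of the following conditions, $f_{\alpha,\beta,c}\in\mathbb{L}_1$ and $f_{\alpha,\beta,c}$ is analytic on $\mathrm{dom}\,f_{\alpha,\beta,c}$: - $\alpha=\beta=1$ and $\mathrm{dom}\,f_{\alpha,\beta,c}=\mathbb{R}$; - $\alpha=2$, $\beta=1$ and $\mathrm{dom}\,f_{\alpha,\beta,c}=\mathbb{R}$; - $\beta<\alpha\le2$, $\beta<1$ and $\mathrm{dom}\,f_{\alpha,\beta,c}=\{\theta\in\mathbb{R}:\theta<c_{2-\beta}\}$, where $c_{2-\beta}=\frac{c^{\beta-1}}{1-\beta}$. If $(\alpha,\beta)=(1,1)$, then the density $$p_{f_{\alpha,\beta,c}}(b;\theta,\sigma^2)=p_1(b;\sigma^2,\alpha,\beta,c)\exp\!\left(\frac{\langle b,\theta\rangle-f_{\alpha,\beta,c}(\theta)}{\sigma^2}\right)$$ is the Bernoulli distribution. If $(\alpha,\beta)=(2,1)$ and $c=1$, then it is the Poisson distribution.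
   Context: Extended exponential function: $\exp_{2-\beta,c}(x)=(c^{\beta-1}+(\beta-1)x)^{\frac{1}{\beta-1}}$ for $\beta\ne1$, and $\exp_{1,c}(x)=c\exp(x)$ for $\beta=1$; its domain is $\{x\in\mathbb{R}:\exp_{2-\beta,c}(x)\in\mathbb{R}\}$ (taken in each case as specified in the statement). Extended logarithmic function: $\ln_{2-\alpha,c}(x)=c_{2-\alpha}-x_{2-\alpha}$ for $\alpha\neq1$, where $y_{2-\alpha}=\frac{y^{\alpha-1}}{1-\alpha}$ (so $\ln_{2-\alpha,c}(x)=\frac{x^{\alpha-1}-c^{\alpha-1}}{\alpha-1}$), and $\ln_{1,c}(x)=\ln x-\ln c$ for $\alpha=1$. Legendre functions: $\mathbb{L}_n$ is the class of lower semicontinuous, convex, proper functions $f:\mathrm{dom} f\subseteq\mathbb{R}^n\to\mathbb{R}$ such that (i) $\mathrm{int}(\mathrm{dom} f)\neq\emptyset$ and $f\in C^1(\mathrm{int}(\mathrm{dom} f))$; (ii) $f$ is strictly convex on $\mathrm{int}(\mathrm{dom} f)$; (iii) (steepness) for all $x\in\mathrm{bd}(\mathrm{dom} f)$ and $y\in\mathrm{int}(\mathrm{dom} f)$, $\lim_{t\downarrow0}\langle\nabla f(x+t(y-x)),y-x\rangle=-\infty$. The density: $\sigma^2>0$ is a dispersion parameter, $b\in\mathcal{B}\subseteq\mathbb{R}$ is the observation, and $p_{f_{\alpha,\beta,c}}(b;\theta,\sigma^2)=p_0(b;\sigma^2,\alpha,\beta,c)\exp(-d_{f^*_{\alpha,\beta,c}}(b;\theta)/\sigma^2)$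 with $d_{f^*}(b;\theta)=f^*(b)+f(\theta)-\langle b,\theta\rangle$ and $f^*$ the convex conjugate of $f$; thus $p_1(b;\sigma^2,\alpha,\beta,c)=p_0(b;\sigma^2,\alpha,\beta,c)\exp(-f^*_{\alpha,\beta,c}(b)/\sigma^2)$. Here $p_1$ is an appropriate base measure (not depending on $\theta$) satisfying $\int_{\mathcal{B}}p_{f_{\alpha,\beta,c}}(b;\theta,\sigma^2)\,\nu(db)=1$, with $\nu$ an appropriate Lebesgue or counting measure.
   Formalization: The base measure is assumed positive on B, with B={0,1} (Bernoulli) or B=ℕ (Poisson) and counting measure; otherwise the claim can fail, e.g. σ²=2 with p_1 supported on even integers gives 2·Poisson(e^θ/2). Lower semicontinuity is relative to dom f. *)

theory Defs
  imports "HOL-Probability.Probability"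
begin

text \<open>Extended logarithm and exponential. The \<open>powr\<close> of the library is the real power for a
  positive base, and it gives \<open>0\<close> for the base \<open>0\<close>; it is meaningful below only on
  \<open>ext_exp_dom\<close> and for positive arguments of \<open>ext_ln\<close>.\<close>

definition ext_sub :: "real \<Rightarrow> real \<Rightarrow> real"  \<comment> \<open>\<open>y\<^sub>2\<^sub>-\<^sub>\<alpha>\<close>\<close>
  where "ext_sub \<alpha> y = y powr (\<alpha> - 1) / (1 - \<alpha>)"

definition ext_ln :: "real \<Rightarrow> real \<Rightarrow> real \<Rightarrow> real"  \<comment> \<open>\<open>ln\<close> with indices \<open>2 - \<alpha>\<close> and \<open>c\<close>\<close>
  where "ext_ln \<alpha> c x = (if \<alpha> = 1 then ln x - ln c else ext_sub \<alpha> c - ext_sub \<alpha> x)"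

definition ext_exp :: "real \<Rightarrow> real \<Rightarrow> real \<Rightarrow> real"  \<comment> \<open>\<open>exp\<close> with indices \<open>2 - \<beta>\<close> and \<open>c\<close>\<close>
  where "ext_exp \<beta> c x =
    (if \<beta> = 1 then c * exp x else (c powr (\<beta> - 1) + (\<beta> - 1) * x) powr (1 / (\<beta> - 1)))"

text \<open>The points where the real power in \<open>ext_exp\<close> is defined: a negative exponent requires a
  positive base, a positive exponent also allows the base \<open>0\<close>.\<close>

definition ext_exp_dom :: "real \<Rightarrow> real \<Rightarrow> real set"
  where "ext_exp_dom \<beta> c =
    (if \<beta> = 1 then UNIV
     else if \<beta> < 1 then {x. 0 < c powr (\<beta> - 1) + (\<beta> - 1) * x}
     else {x. 0 \<le> c powr (\<beta> - 1) + (\<beta> - 1) * x})"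

definition ext_logistic :: "real \<Rightarrow> real \<Rightarrow> real \<Rightarrow> real \<Rightarrow> real"
  where "ext_logistic \<alpha> \<beta> c \<theta> = ext_ln \<alpha> c (c + ext_exp \<beta> c \<theta>)"

text \<open>A function \<open>dom f \<rightarrow> \<real>\<close> is represented by a total function together with its domain \<open>D\<close>.
  Lower semicontinuity is that of a real-valued function on \<open>D\<close>, relative to \<open>D\<close>; it is not
  closedness of the extension of \<open>f\<close> by \<open>\<infinity>\<close>.\<close>

definition lsc_on :: "'a::topological_space set \<Rightarrow> ('a \<Rightarrow> real) \<Rightarrow> bool"
  where "lsc_on D f \<longleftrightarrow> (\<forall>x\<in>D. \<forall>y < f x. eventually (\<lambda>z. y < f z) (at x within D))"

definition strictly_convex_on :: "'a::real_vector set \<Rightarrow> ('a \<Rightarrow> real) \<Rightarrow> bool"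
  where "strictly_convex_on S f \<longleftrightarrow> convex S \<and>
    (\<forall>x\<in>S. \<forall>y\<in>S. \<forall>u>0. \<forall>v>0. x \<noteq> y \<longrightarrow> u + v = 1 \<longrightarrow>
       f (u *\<^sub>R x + v *\<^sub>R y) < u * f x + v * f y)"

text \<open>The function \<open>g\<close> is the gradient of \<open>f\<close>, which is unique on the interior. Its values elsewhere
  play no role: for \<open>x\<close> in the frontier, \<open>y\<close> in the interior and \<open>0 < t \<le> 1\<close>, the point
  \<open>x + t (y - x)\<close> is interior. As \<open>f\<close> has finite values, properness is \<open>D \<noteq> {}\<close>.\<close>

definition legendre :: "'a::euclidean_space set \<Rightarrow> ('a \<Rightarrow> real) \<Rightarrow> bool"
  where "legendre D f \<longleftrightarrow>
    lsc_on D f \<and> convex_on D f \<and> D \<noteq> {} \<and>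
    interior D \<noteq> {} \<and>
    strictly_convex_on (interior D) f \<and>
    (\<exists>g. (\<forall>x\<in>interior D. GDERIV f x :> g x) \<and> continuous_on (interior D) g \<and>
         (\<forall>x\<in>frontier D. \<forall>y\<in>interior D.
            filterlim (\<lambda>t. inner (g (x + t *\<^sub>R (y - x))) (y - x)) at_bot (at_right 0)))"

definition real_analytic_on :: "real set \<Rightarrow> (real \<Rightarrow> real) \<Rightarrow> bool"
  where "real_analytic_on D f \<longleftrightarrow> (\<forall>x\<in>D. \<exists>F. (\<lambda>h. f (x + h)) has_fps_expansion F)"

definition conjugate :: "real set \<Rightarrow> (real \<Rightarrow> real) \<Rightarrow> real \<Rightarrow> ereal"
  where "conjugate D f b = (SUP \<theta>\<in>D. ereal (b * \<theta> - f \<theta>))"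

text \<open>Conversion of the conjugate to a real number is harmless where it is finite; this is part
  of \<open>edm_base\<close> below.\<close>

definition fenchel_young :: "real set \<Rightarrow> (real \<Rightarrow> real) \<Rightarrow> real \<Rightarrow> real \<Rightarrow> real"
  where "fenchel_young D f b \<theta> = real_of_ereal (conjugate D f b) + f \<theta> - b * \<theta>"

definition edm_density ::
    "real set \<Rightarrow> (real \<Rightarrow> real) \<Rightarrow> (real \<Rightarrow> real) \<Rightarrow> real \<Rightarrow> real \<Rightarrow> real \<Rightarrow> real"
  where "edm_density D f p0 \<sigma>2 b \<theta> = p0 b * exp (- fenchel_young D f b \<theta> / \<sigma>2)"

definition edm_p1 :: "real set \<Rightarrow> (real \<Rightarrow> real) \<Rightarrow> (real \<Rightarrow> real) \<Rightarrow> real \<Rightarrow> real \<Rightarrow> real"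
  where "edm_p1 D f p0 \<sigma>2 b = p0 b * exp (- real_of_ereal (conjugate D f b) / \<sigma>2)"

text \<open>\<open>p0\<close> is an appropriate base for the observation space \<open>B\<close> and the reference measure \<open>\<nu>\<close>:
  one function \<open>p0\<close> normalises the density for every parameter \<open>\<theta>\<close>. It is positive on \<open>B\<close>, that is,
  \<open>B\<close> contains only values that can be observed.\<close>

definition edm_base ::
    "real set \<Rightarrow> (real \<Rightarrow> real) \<Rightarrow> real set \<Rightarrow> real measure \<Rightarrow> real \<Rightarrow> (real \<Rightarrow> real) \<Rightarrow> bool"
  where "edm_base D f B \<nu> \<sigma>2 p0 \<longleftrightarrow>
    (\<forall>b\<in>B. \<bar>conjugate D f b\<bar> \<noteq> \<infinity> \<and> 0 < p0 b) \<and>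
    (\<forall>\<theta>\<in>D. (\<integral>\<^sup>+ b\<in>B. ennreal (edm_density D f p0 \<sigma>2 b \<theta>) \<partial>\<nu>) = 1)"

end

theory Submission
  imports Defs "HOL-Complex_Analysis.Complex_Analysis"
begin

text \<open>
  Write \<open>e = ext_exp \<beta> c \<theta>\<close>, which is positive and strictly increasing in \<open>\<theta>\<close>. The extended
  exponential solves \<open>e' = e powr (2 - \<beta>)\<close> and the extended logarithm has the derivative
  \<open>x powr (\<alpha> - 2)\<close>, so in all cases of the theorem the slope of the loss is
  \<open>(c + e) powr (\<alpha> - 2) * e powr (2 - \<beta>) = (1 + c / e) powr (\<alpha> - 2) * e powr (\<alpha> - \<beta>)\<close>.
  For \<open>\<beta> \<le> \<alpha> \<le> 2\<close> both factors of the right-hand side are nondecreasing in \<open>e\<close>, and since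
  \<open>\<beta> \<le> 1\<close> rules out \<open>\<alpha> = \<beta> = 2\<close>, one of them is strictly increasing
  (\<open>ext_logistic_slope_less\<close>). This gives strict convexity. Only for \<open>\<beta> < 1\<close> has the domain a
  boundary point; there \<open>e \<rightarrow> \<infinity>\<close>, and for \<open>\<beta> < \<alpha>\<close> the slope tends to infinity with it
  (\<open>ext_logistic_steep\<close>). Analyticity holds because the loss is the restriction of a complex
  analytic function (\<open>has_fps_expansion_of_complex_analytic\<close>).

  For the densities, the conjugate of \<open>f\<close> cancels, and a base amounts to positive weights
  \<open>p\<^sub>1(b)\<close> that satisfy the normalisation identity for every \<open>\<theta>\<close>. This identity determines the
  weights and the dispersion together. In the Bernoulli case the limits \<open>\<theta> \<rightarrow> \<plusminus>\<infinity>\<close> show that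
  both weights are \<open>1\<close>, and \<open>\<theta> = 0\<close> then forces \<open>\<sigma>\<^sup>2 = 1\<close> (\<open>bernoulli_weights_unique\<close>). In the
  Poisson case the identity is the power series
  \<open>(\<Sum>n. p\<^sub>1(n) x\<^sup>n) = exp (x powr \<sigma>\<^sup>2 / \<sigma>\<^sup>2)\<close> for \<open>x > 0\<close>: the left-hand side has a finite nonzero
  derivative at \<open>0\<close>, and the right-hand side behaves so only for \<open>\<sigma>\<^sup>2 = 1\<close>; the series of the
  exponential function then gives \<open>p\<^sub>1(n) = 1 / n!\<close> (\<open>poisson_weights_unique\<close>).
\<close>

section \<open>Real analyticity from complex analyticity\<close>

text \<open>On the reals, the real parts of the complex Taylor coefficients already give the real function.
  Going through the complex plane makes sums, compositions and powers available at once.\<close>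

lemma has_fps_expansion_of_complex_analytic:
  fixes f :: "real \<Rightarrow> real"
  assumes "g analytic_on {complex_of_real x}"
    and "\<forall>\<^sub>F y in nhds x. g (of_real y) = of_real (f y)"
  shows "\<exists>F. (\<lambda>h. f (x + h)) has_fps_expansion F"
proof -
  define G where "G = fps_expansion g (of_real x)"
  have "(\<lambda>z. g (of_real x + z)) has_fps_expansion G"
    unfolding G_def by (rule analytic_at_imp_has_fps_expansion[OF assms(1)])
  then have rad: "fps_conv_radius G > 0"
    and ev: "\<forall>\<^sub>F z in nhds 0. eval_fps G z = g (of_real x + z)"
    by (auto simp: has_fps_expansion_def)
  have "\<forall>\<^sub>F z in nhds (0::complex). z \<in> eball 0 (fps_conv_radius G)"
    using rad by (intro eventually_nhds_in_open) (auto simp: zero_ereal_def)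
  with ev have "\<forall>\<^sub>F z in nhds 0. (\<lambda>n. fps_nth G n * z ^ n) sums g (of_real x + z)"
    by eventually_elim (use sums_eval_fps in force)
  moreover have "filterlim complex_of_real (nhds 0) (nhds (0::real))"
    using tendsto_of_real[OF filterlim_ident, of "0::real"] by simp
  ultimately have 1: "\<forall>\<^sub>F h in nhds (0::real).
      (\<lambda>n. fps_nth G n * of_real h ^ n) sums g (of_real x + of_real h)"
    by (rule eventually_compose_filterlim)
  have "filterlim (\<lambda>h. x + h) (nhds x) (nhds (0::real))"
    using tendsto_add[OF tendsto_const filterlim_ident, of x "0::real"] by simp
  then have 2: "\<forall>\<^sub>F h in nhds 0. g (of_real (x + h)) = of_real (f (x + h))"
    using assms(2) by (rule eventually_compose_filterlim[rotated])
  have "\<forall>\<^sub>F h in nhds 0. (\<lambda>n. fps_nth (Abs_fps (\<lambda>n. Re (fps_nth G n))) n * h ^ n) sums f (x + h)"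
    using 1 2
  proof eventually_elim
    case (elim h)
    then have "(\<lambda>n. Re (fps_nth G n * of_real h ^ n)) sums Re (of_real (f (x + h)))"
      by (intro sums_Re) simp
    then show ?case
      by (simp flip: of_real_power)
  qed
  then show ?thesis
    by (blast intro: has_fps_expansionI)
qed

section \<open>Convexity and the Legendre property from the derivative\<close>

text \<open>The mean value theorem on both sides of an intermediate point compares the two chord slopes
  with the derivative at two ordered points.\<close>

lemma strictly_convex_on_of_deriv:
  fixes f g :: "real \<Rightarrow> real"
  assumes S: "convex S"
    and deriv: "\<And>x. x \<in> S \<Longrightarrow> (f has_real_derivative g x) (at x)"
    and mono: "\<And>x y. x \<in> S \<Longrightarrow> y \<in> S \<Longrightarrow> x < y \<Longrightarrow> g x < g y"
  shows "strictly_convex_on S f"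
proof -
  have main: "f (u * x + v * y) < u * f x + v * f y"
    if xy: "x \<in> S" "y \<in> S" "x < y" and uv: "u > 0" "v > 0" "u + v = 1" for x y u v
  proof -
    define z where "z = u * x + v * y"
    have u: "u = 1 - v" using uv by simp
    have zx: "z - x = v * (y - x)" and yz: "y - z = u * (y - x)"
      unfolding z_def u by (simp_all add: algebra_simps)
    have "x < z" "z < y"
      using zx yz uv xy by (metis diff_gt_0_iff_gt mult_pos_pos)+
    have sub: "{x..y} \<subseteq> S"
      using S xy by (metis atLeastAtMost_iff closed_segment_eq_real_ivl1 convex_contains_segment less_imp_le subsetI)
    \<comment> \<open>The mean value theorem on the two halves gives \<open>s < z < t\<close>.\<close>
    obtain s where s: "x < s" "s < z" "f z - f x = (z - x) * g s"
      using MVT2[of x z f g] \<open>x < z\<close> \<open>z < y\<close> deriv sub by (metis atLeastAtMost_iff less_le_trans less_imp_le subsetD order_trans)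
    obtain t where t: "z < t" "t < y" "f y - f z = (y - z) * g t"
      using MVT2[of z y f g] \<open>x < z\<close> \<open>z < y\<close> deriv sub by (metis atLeastAtMost_iff less_le_trans less_imp_le subsetD order_trans)
    have "s \<in> S" "t \<in> S" using sub s t \<open>x < z\<close> \<open>z < y\<close> by (auto simp: subset_iff)
    then have "g s < g t" using mono s t by simp
    have "u * f x + v * f y - f z = v * (f y - f z) - u * (f z - f x)"
      unfolding u by (simp add: algebra_simps)
    also have "\<dots> = u * v * (y - x) * (g t - g s)"
      unfolding s t zx yz by (simp add: algebra_simps)
    also have "\<dots> > 0"
      using \<open>g s < g t\<close> uv xy by simp
    finally show ?thesis by (simp add: z_def)
  qed
  show ?thesis
    unfolding strictly_convex_on_def
  proof (intro conjI S ballI allI impI)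
    fix x y u v :: real
    assume *: "x \<in> S" "y \<in> S" "u > 0" "v > 0" "x \<noteq> y" "u + v = 1"
    show "f (u *\<^sub>R x + v *\<^sub>R y) < u * f x + v * f y"
      using main[of x y u v] main[of y x v u] * by (cases "x < y") (auto simp: add.commute)
  qed
qed

lemma strictly_convex_on_imp_convex_on:
  fixes f :: "'a::real_vector \<Rightarrow> real"
  assumes "strictly_convex_on S f"
  shows "convex_on S f"
proof -
  have "f (u *\<^sub>R x + v *\<^sub>R y) \<le> u * f x + v * f y"
    if "x \<in> S" "y \<in> S" "u \<ge> 0" "v \<ge> 0" "u + v = 1" for x y u v
  proof (cases "u = 0 \<or> v = 0 \<or> x = y")
    case True
    with that show ?thesis by (auto simp flip: scaleR_left_distrib distrib_right)
  next
    case False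
    with that assms have "f (u *\<^sub>R x + v *\<^sub>R y) < u * f x + v * f y"
      unfolding strictly_convex_on_def by (metis less_le)
    then show ?thesis by simp
  qed
  with assms show ?thesis
    by (auto simp: convex_on_def strictly_convex_on_def)
qed

text \<open>Lower semicontinuity follows from differentiability and convexity from monotonicity of the
  derivative, so for each parameter range only the slope of the loss has to be studied.\<close>

lemma legendre_open_of_deriv:
  fixes f g :: "real \<Rightarrow> real"
  assumes D: "open D" "convex D" "D \<noteq> {}"
    and deriv: "\<And>x. x \<in> D \<Longrightarrow> (f has_real_derivative g x) (at x)"
    and mono: "\<And>x y. x \<in> D \<Longrightarrow> y \<in> D \<Longrightarrow> x < y \<Longrightarrow> g x < g y"
    and cont: "continuous_on D g"
    and steep: "\<And>x y. x \<in> frontier D \<Longrightarrow> y \<in> D \<Longrightarrow>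
      filterlim (\<lambda>t. g (x + t * (y - x)) * (y - x)) at_bot (at_right 0)"
  shows "legendre D f"
proof -
  have int: "interior D = D" using D by (simp add: interior_open)
  have strict: "strictly_convex_on D f"
    by (rule strictly_convex_on_of_deriv[OF D(2) deriv mono])
  have "lsc_on D f"
    unfolding lsc_on_def
  proof (intro ballI allI impI)
    fix x y assume "x \<in> D" "y < f x"
    then have "(f \<longlongrightarrow> f x) (at x within D)"
      using DERIV_isCont[OF deriv] by (auto simp: isCont_def intro: tendsto_within_subset)
    then show "\<forall>\<^sub>F z in at x within D. y < f z"
      using \<open>y < f x\<close> by (rule order_tendstoD)
  qed
  moreover have "GDERIV f x :> g x" if "x \<in> D" for x
    using deriv[OF that] by (simp add: gderiv_def has_field_derivative_def mult_commute_abs)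
  ultimately show ?thesis
    using strict strictly_convex_on_imp_convex_on[OF strict] D cont steep
    unfolding legendre_def int by (auto intro!: exI[of _ g])
qed

section \<open>Uniqueness of dispersion and weights\<close>

text \<open>The power series is differentiable at \<open>0\<close> with derivative \<open>a 1\<close>, and its derivative is
  continuous there. For \<open>x > 0\<close> this derivative is \<open>x powr (\<sigma> - 1) * exp (x powr \<sigma> / \<sigma>)\<close>, which
  tends to infinity at \<open>0\<close> for \<open>\<sigma> < 1\<close> and to \<open>0\<close> for \<open>\<sigma> > 1\<close>. The condition on \<open>a 1\<close>
  is essential: \<open>\<sigma> = 2\<close> gives the power series of \<open>exp (x\<^sup>2 / 2)\<close>.\<close>

lemma exponent_1_of_exp_powr_series:
  fixes a :: "nat \<Rightarrow> real"
  assumes \<sigma>: "\<sigma> > 0" and a1: "a 1 \<noteq> 0"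
    and sums: "\<And>x. x > 0 \<Longrightarrow> (\<lambda>n. a n * x ^ n) sums exp (x powr \<sigma> / \<sigma>)"
  shows "\<sigma> = 1"
proof -
  define F where "F x = (\<Sum>n. a n * x ^ n)" for x
  define F' where "F' x = (\<Sum>n. diffs a n * x ^ n)" for x
  have summable: "summable (\<lambda>n. a n * x ^ n)" for x
    by (rule powser_inside[of _ "\<bar>x\<bar> + 1"]) (use sums[of "\<bar>x\<bar> + 1"] in \<open>auto simp: sums_iff\<close>)
  have F: "(F has_real_derivative F' x) (at x)" for x
    unfolding F_def F'_def by (rule termdiffs_strong_converges_everywhere[OF summable])
  have "isCont F' 0"
    unfolding F'_def
    by (rule isCont_powser_converges_everywhere) (rule termdiff_converges_all[OF summable])
  then have "(F' \<longlongrightarrow> F' 0) (at_right 0)"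
    by (auto simp: isCont_def intro: tendsto_within_subset)
  moreover have "F' 0 = a 1"
    by (simp add: F'_def diffs_def)
  moreover have F'_eq: "F' x = x powr (\<sigma> - 1) * exp (x powr \<sigma> / \<sigma>)" if "x > 0" for x
  proof (rule DERIV_unique[OF F])
    have "((\<lambda>x. exp (x powr \<sigma> / \<sigma>)) has_real_derivative x powr (\<sigma> - 1) * exp (x powr \<sigma> / \<sigma>)) (at x)"
      using that \<sigma> by (auto intro!: derivative_eq_intros)
    moreover have "\<forall>\<^sub>F y in nhds x. exp (y powr \<sigma> / \<sigma>) = F y"
      using eventually_nhds_in_open[of "{0<..}" x] that
      by (auto elim!: eventually_mono simp: F_def sums_iff dest: sums)
    ultimately show "(F has_real_derivative x powr (\<sigma> - 1) * exp (x powr \<sigma> / \<sigma>)) (at x)"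
      by (subst (asm) DERIV_cong_ev[OF refl _ refl, where g = F]) auto
  qed
  ultimately have lim: "((\<lambda>x. x powr (\<sigma> - 1) * exp (x powr \<sigma> / \<sigma>)) \<longlongrightarrow> a 1) (at_right 0)"
    by (auto elim!: Lim_transform_eventually simp: eventually_at_filter)
  show ?thesis
  proof (cases \<sigma> "1::real" rule: linorder_cases)
    case less
    have "filterlim (\<lambda>x. x powr (\<sigma> - 1) * exp (x powr \<sigma> / \<sigma>)) at_top (at_right 0)"
      using less \<sigma> by real_asymp
    with lim show ?thesis
      using not_tendsto_and_filterlim_at_infinity[of "at_right (0::real)"]
      by (auto dest: filterlim_at_top_imp_at_infinity)
  next
    case greater
    have "((\<lambda>x. x powr (\<sigma> - 1) * exp (x powr \<sigma> / \<sigma>)) \<longlongrightarrow> 0) (at_right 0)"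
      using greater by real_asymp
    with lim a1 show ?thesis
      using tendsto_unique[of "at_right (0::real)"] by auto
  qed
qed

text \<open>The zeros of a nonzero power series are isolated, but \<open>0\<close> is a limit of positive numbers.\<close>

lemma powser_eq_0_on_pos:
  fixes d :: "nat \<Rightarrow> real"
  assumes "\<And>x. x > 0 \<Longrightarrow> (\<lambda>n. d n * x ^ n) sums 0"
  shows "d n = 0"
proof (rule ccontr)
  assume "d n \<noteq> 0"
  define F where "F x = (\<Sum>n. d n * x ^ n)" for x
  have summable: "summable (\<lambda>n. d n * x ^ n)" for x
    by (rule powser_inside[of _ "\<bar>x\<bar> + 1"]) (use assms[of "\<bar>x\<bar> + 1"] in \<open>auto simp: sums_iff\<close>)
  have zero: "F x = 0" if "x > 0" for x
    using assms[OF that] by (simp add: F_def sums_iff)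
  have "isCont F 0"
    unfolding F_def by (rule isCont_powser_converges_everywhere[OF summable])
  then have "(F \<longlongrightarrow> F 0) (at_right 0)"
    by (auto simp: isCont_def intro: tendsto_within_subset)
  moreover have "(F \<longlongrightarrow> 0) (at_right 0)"
    by (rule tendsto_eventually) (auto simp: eventually_at_filter zero)
  ultimately have F0: "F 0 = 0"
    using tendsto_unique[of "at_right (0::real)"] by auto
  then have "d 0 = 0" by (simp add: F_def)
  with \<open>d n \<noteq> 0\<close> have "n > 0" by (cases n) auto
  obtain s where "0 < s" and s: "\<And>z. z \<in> cball 0 s - {0} \<Longrightarrow> F z \<noteq> 0"
  proof (rule powser_0_nonzero[of 1 0 d F n])
    show "(\<lambda>n. d n * (x - 0) ^ n) sums F x" for x
      using summable[of x] by (simp add: F_def summable_sums)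
  qed (use F0 \<open>d n \<noteq> 0\<close> \<open>n > 0\<close> in auto)
  with s[of s] zero[of s] show False by auto
qed

lemma poisson_weights_unique:
  fixes a :: "nat \<Rightarrow> real"
  assumes \<sigma>: "\<sigma> > 0" and a1: "a 1 \<noteq> 0"
    and sums: "\<And>x. x > 0 \<Longrightarrow> (\<lambda>n. a n * x ^ n) sums exp (x powr \<sigma> / \<sigma>)"
  shows "\<sigma> = 1 \<and> a n = 1 / fact n"
proof -
  have "\<sigma> = 1" by (rule exponent_1_of_exp_powr_series[OF assms])
  have "(\<lambda>n. (a n - 1 / fact n) * x ^ n) sums 0" if "x > 0" for x
    using sums_diff[OF sums[OF that] exp_converges[of x]] that \<open>\<sigma> = 1\<close>
    by (simp add: algebra_simps divide_inverse)
  from powser_eq_0_on_pos[OF this] \<open>\<sigma> = 1\<close> show ?thesis by simp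
qed

text \<open>As \<open>\<theta> \<rightarrow> -\<infinity>\<close> the left-hand side tends to \<open>p\<close>, as \<open>\<theta> \<rightarrow> \<infinity>\<close> to \<open>q\<close>; at \<open>\<theta> = 0\<close> it is
  then \<open>2 powr (1 - 1 / \<sigma>)\<close>.\<close>

lemma bernoulli_weights_unique:
  fixes p q \<sigma> :: real
  assumes \<sigma>: "\<sigma> > 0"
    and eq: "\<And>\<theta>. p * exp (- ln (1 + exp \<theta>) / \<sigma>) + q * exp ((\<theta> - ln (1 + exp \<theta>)) / \<sigma>) = 1"
  shows "\<sigma> = 1 \<and> p = 1 \<and> q = 1"
proof -
  let ?h = "\<lambda>\<theta>. p * exp (- ln (1 + exp \<theta>) / \<sigma>) + q * exp ((\<theta> - ln (1 + exp \<theta>)) / \<sigma>)"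
  have "((\<lambda>\<theta>. exp (- ln (1 + exp \<theta>) / \<sigma>)) \<longlongrightarrow> 1) at_bot"
    using \<sigma> by real_asymp
  moreover have "((\<lambda>\<theta>. exp ((\<theta> - ln (1 + exp \<theta>)) / \<sigma>)) \<longlongrightarrow> 0) at_bot"
    using \<sigma> by real_asymp
  ultimately have "(?h \<longlongrightarrow> p * 1 + q * 0) at_bot"
    by (intro tendsto_intros)
  then have p: "p = 1"
    unfolding eq by (simp add: tendsto_const_iff)
  have "((\<lambda>\<theta>. exp (- ln (1 + exp \<theta>) / \<sigma>)) \<longlongrightarrow> 0) at_top"
    using \<sigma> by real_asymp
  moreover have "((\<lambda>\<theta>. exp ((\<theta> - ln (1 + exp \<theta>)) / \<sigma>)) \<longlongrightarrow> 1) at_top"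
    using \<sigma> by real_asymp
  ultimately have "(?h \<longlongrightarrow> p * 0 + q * 1) at_top"
    by (intro tendsto_intros)
  then have q: "q = 1"
    unfolding eq by (simp add: tendsto_const_iff)
  have "2 * exp (- ln 2 / \<sigma>) = 1"
    using eq[of 0] p q by simp
  then have "exp (ln 2 - ln 2 / \<sigma>) = exp (0 :: real)"
    by (simp add: exp_diff exp_minus field_simps)
  then have "ln 2 * (1 - 1 / \<sigma>) = (0::real)"
    by (simp only: exp_inj_iff) (simp add: algebra_simps)
  with \<sigma> p q show ?thesis by simp
qed

section \<open>The convex extended logistic loss\<close>

lemma ext_exp_dom_less_1:
  assumes "\<beta> < 1"
  shows "ext_exp_dom \<beta> c = {..<ext_sub \<beta> c}"
proof -
  have "0 < c powr (\<beta> - 1) + (\<beta> - 1) * x \<longleftrightarrow> x < ext_sub \<beta> c" for x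
  proof -
    have "x < ext_sub \<beta> c \<longleftrightarrow> x * (1 - \<beta>) < c powr (\<beta> - 1)"
      unfolding ext_sub_def using assms by (intro pos_less_divide_eq) simp
    then show ?thesis
      by (simp add: algebra_simps)
  qed
  with assms show ?thesis
    by (auto simp: ext_exp_dom_def)
qed

lemma open_convex_ext_exp_dom:
  assumes "\<beta> \<le> 1"
  shows "open (ext_exp_dom \<beta> c)" "convex (ext_exp_dom \<beta> c)" "ext_exp_dom \<beta> c \<noteq> {}"
proof -
  consider "ext_exp_dom \<beta> c = UNIV" | "ext_exp_dom \<beta> c = {..<ext_sub \<beta> c}"
    using assms ext_exp_dom_less_1[of \<beta> c] by (cases "\<beta> = 1") (simp_all add: ext_exp_dom_def)
  then have "open (ext_exp_dom \<beta> c) \<and> convex (ext_exp_dom \<beta> c) \<and> ext_exp_dom \<beta> c \<noteq> {}"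
    by cases (simp_all add: convex_real_interval)
  then show "open (ext_exp_dom \<beta> c)" "convex (ext_exp_dom \<beta> c)" "ext_exp_dom \<beta> c \<noteq> {}"
    by blast+
qed

lemma ext_exp_pos:
  assumes "c > 0" "\<beta> \<le> 1" "\<theta> \<in> ext_exp_dom \<beta> c"
  shows "ext_exp \<beta> c \<theta> > 0"
proof (cases "\<beta> = 1")
  case True
  with assms show ?thesis by (simp add: ext_exp_def)
next
  case False
  with assms have "c powr (\<beta> - 1) + (\<beta> - 1) * \<theta> > 0"
    by (simp add: ext_exp_dom_def)
  with False show ?thesis
    unfolding ext_exp_def powr_gt_zero by simp
qed

lemma ext_exp_less:
  assumes "c > 0" "\<beta> \<le> 1" "x \<in> ext_exp_dom \<beta> c" "y \<in> ext_exp_dom \<beta> c" "x < y"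
  shows "ext_exp \<beta> c x < ext_exp \<beta> c y"
proof (cases "\<beta> = 1")
  case True
  with assms show ?thesis by (simp add: ext_exp_def)
next
  case False
  with assms have \<beta>: "\<beta> < 1" by simp
  have "c powr (\<beta> - 1) + (\<beta> - 1) * y < c powr (\<beta> - 1) + (\<beta> - 1) * x"
    using \<beta> assms by simp
  with \<beta> assms show ?thesis
    unfolding ext_exp_def ext_exp_dom_def by (auto intro!: powr_less_mono2_neg)
qed

lemma ext_exp_deriv:
  assumes c: "c > 0" and \<beta>: "\<beta> \<le> 1" and \<theta>: "\<theta> \<in> ext_exp_dom \<beta> c"
  shows "(ext_exp \<beta> c has_real_derivative ext_exp \<beta> c \<theta> powr (2 - \<beta>)) (at \<theta>)"
proof (cases "\<beta> = 1")
  case True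
  then have eq: "ext_exp \<beta> c = (\<lambda>x. c * exp x)"
    by (simp add: ext_exp_def fun_eq_iff)
  show ?thesis
    unfolding eq using True c by (auto intro!: derivative_eq_intros)
next
  case False
  with \<beta> have \<beta>: "\<beta> < 1" by simp
  define p where "p = 1 / (\<beta> - 1)"
  define u where "u x = c powr (\<beta> - 1) + (\<beta> - 1) * x" for x
  have eq: "ext_exp \<beta> c = (\<lambda>x. u x powr p)"
    using False by (simp add: ext_exp_def p_def u_def fun_eq_iff)
  have u: "u \<theta> > 0"
    using \<theta> \<beta> by (simp add: ext_exp_dom_def u_def)
  have p: "p * (2 - \<beta>) = p - 1" "p * (\<beta> - 1) = 1"
    using \<beta> by (simp_all add: p_def field_simps)
  have "(u has_real_derivative (\<beta> - 1)) (at \<theta>)"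
    unfolding u_def by (auto intro!: derivative_eq_intros)
  from DERIV_fun_powr[OF this u, of p]
  have "((\<lambda>x. u x powr p) has_real_derivative u \<theta> powr (p - 1)) (at \<theta>)"
    using p(2) by (simp add: mult.assoc) (metis mult.assoc mult.commute mult_1)
  also have "u \<theta> powr (p - 1) = (u \<theta> powr p) powr (2 - \<beta>)"
    by (simp add: powr_powr p(1))
  finally show ?thesis unfolding eq .
qed

lemma ext_ln_deriv:
  assumes "x > 0"
  shows "(ext_ln \<alpha> c has_real_derivative x powr (\<alpha> - 2)) (at x)"
proof (cases "\<alpha> = 1")
  case True
  then have eq: "ext_ln \<alpha> c = (\<lambda>x. ln x - ln c)"
    by (simp add: ext_ln_def fun_eq_iff)
  show ?thesis
    unfolding eq using assms True
    by (auto intro!: derivative_eq_intros simp: powr_minus divide_inverse)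
next
  case False
  then have eq: "ext_ln \<alpha> c = (\<lambda>x. ext_sub \<alpha> c + x powr (\<alpha> - 1) * (1 / (\<alpha> - 1)))"
    by (simp add: ext_ln_def ext_sub_def fun_eq_iff divide_simps) (simp add: algebra_simps)
  show ?thesis
    unfolding eq using assms False
    by (auto intro!: derivative_eq_intros)
qed

text \<open>The slope of the loss as a function of the value \<open>e\<close> of the extended exponential. This variable
  turns monotonicity and steepness into statements on \<open>e > 0\<close> that do not mention the domain.\<close>

definition ext_logistic_slope :: "real \<Rightarrow> real \<Rightarrow> real \<Rightarrow> real \<Rightarrow> real"
  where "ext_logistic_slope \<alpha> \<beta> c e = (c + e) powr (\<alpha> - 2) * e powr (2 - \<beta>)"

lemma ext_logistic_deriv:
  assumes "c > 0" "\<beta> \<le> 1" "\<theta> \<in> ext_exp_dom \<beta> c"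
  shows "(ext_logistic \<alpha> \<beta> c has_real_derivative
           ext_logistic_slope \<alpha> \<beta> c (ext_exp \<beta> c \<theta>)) (at \<theta>)"
proof -
  have E: "((\<lambda>x. c + ext_exp \<beta> c x) has_real_derivative ext_exp \<beta> c \<theta> powr (2 - \<beta>)) (at \<theta>)"
    using ext_exp_deriv[OF assms] by (auto intro!: derivative_eq_intros)
  have "c + ext_exp \<beta> c \<theta> > 0"
    using ext_exp_pos[OF assms] assms by simp
  from DERIV_chain2[OF ext_ln_deriv[OF this] E] show ?thesis
    by (simp add: ext_logistic_def[abs_def] ext_logistic_slope_def)
qed

text \<open>Factoring \<open>e\<close> out of \<open>c + e\<close> separates the two conditions on the parameters: \<open>\<alpha> \<le> 2\<close> makes
  the factor \<open>(1 + c / e) powr (\<alpha> - 2)\<close> nondecreasing, \<open>\<beta> \<le> \<alpha>\<close> the factor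
  \<open>e powr (\<alpha> - \<beta>)\<close>.\<close>

lemma ext_logistic_slope_less:
  assumes c: "c > 0" and \<alpha>\<beta>: "\<beta> \<le> 1" "\<beta> \<le> \<alpha>" "\<alpha> \<le> 2" and e: "0 < d" "d < e"
  shows "ext_logistic_slope \<alpha> \<beta> c d < ext_logistic_slope \<alpha> \<beta> c e"
proof -
  have eq: "ext_logistic_slope \<alpha> \<beta> c x = (1 + c / x) powr (\<alpha> - 2) * x powr (\<alpha> - \<beta>)" if "x > 0" for x
  proof -
    have "c + x = (1 + c / x) * x" using that by (simp add: field_simps)
    then have "(c + x) powr (\<alpha> - 2) = (1 + c / x) powr (\<alpha> - 2) * x powr (\<alpha> - 2)"
      using c that by (simp add: powr_mult)
    then show ?thesis
      by (simp add: ext_logistic_slope_def mult.assoc flip: powr_add)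
  qed
  have pos: "1 + c / d > 0" "1 + c / e > 0" "1 + c / e < 1 + c / d"
    using c e by (auto intro!: add_pos_pos divide_strict_left_mono)
  have le1: "(1 + c / d) powr (\<alpha> - 2) \<le> (1 + c / e) powr (\<alpha> - 2)"
    using pos \<alpha>\<beta> by (intro powr_mono2') auto
  have le2: "d powr (\<alpha> - \<beta>) \<le> e powr (\<alpha> - \<beta>)"
    using e \<alpha>\<beta> by (intro powr_mono2) auto
  have "(1 + c / d) powr (\<alpha> - 2) * d powr (\<alpha> - \<beta>) < (1 + c / e) powr (\<alpha> - 2) * e powr (\<alpha> - \<beta>)"
  proof (cases "\<alpha> < 2")
    case True
    then have "(1 + c / d) powr (\<alpha> - 2) < (1 + c / e) powr (\<alpha> - 2)"
      using pos by (intro powr_less_mono2_neg) auto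
    then show ?thesis using le2 e by (intro mult_less_le_imp_less) auto
  next
    case False
    then have "d powr (\<alpha> - \<beta>) < e powr (\<alpha> - \<beta>)"
      using e \<alpha>\<beta> by (intro powr_less_mono2) auto
    then show ?thesis using le1 pos by (intro mult_le_less_imp_less) auto
  qed
  then show ?thesis using e by (simp add: eq)
qed

text \<open>On the segment towards the boundary point the base of the power in \<open>ext_exp\<close> is \<open>k * t\<close> with
  \<open>k > 0\<close>, so the extended exponential is a negative power of \<open>t\<close>. The slope grows like
  \<open>e powr (\<alpha> - \<beta>)\<close> for large \<open>e\<close>.\<close>

lemma ext_logistic_steep:
  assumes c: "c > 0" and \<alpha>\<beta>: "\<beta> < 1" "\<beta> < \<alpha>" and y: "y < ext_sub \<beta> c"
  shows "filterlim (\<lambda>t. ext_logistic_slope \<alpha> \<beta> c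
           (ext_exp \<beta> c (ext_sub \<beta> c + t * (y - ext_sub \<beta> c))) * (y - ext_sub \<beta> c))
           at_bot (at_right 0)"
proof -
  define k where "k = (1 - \<beta>) * (ext_sub \<beta> c - y)"
  define p where "p = 1 / (\<beta> - 1)"
  have k: "k > 0" and p: "p < 0"
    using \<alpha>\<beta> y by (auto simp: k_def p_def)
  have eq: "ext_exp \<beta> c (ext_sub \<beta> c + t * (y - ext_sub \<beta> c)) = (k * t) powr p" for t
  proof -
    have "c powr (\<beta> - 1) = (1 - \<beta>) * ext_sub \<beta> c"
      using \<alpha>\<beta> by (simp add: ext_sub_def)
    then have "c powr (\<beta> - 1) + (\<beta> - 1) * (ext_sub \<beta> c + t * (y - ext_sub \<beta> c)) = k * t"
      by (simp add: k_def algebra_simps)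
    with \<alpha>\<beta> show ?thesis by (simp add: ext_exp_def p_def)
  qed
  have "filterlim (\<lambda>t. (k * t) powr p) at_top (at_right 0)"
    using k p by real_asymp
  moreover have "filterlim (ext_logistic_slope \<alpha> \<beta> c) at_top at_top"
    unfolding ext_logistic_slope_def[abs_def] using c \<alpha>\<beta> by real_asymp
  ultimately have "filterlim (\<lambda>t. ext_logistic_slope \<alpha> \<beta> c ((k * t) powr p)) at_top (at_right 0)"
    by (rule filterlim_compose[rotated])
  from filterlim_tendsto_neg_mult_at_bot[OF tendsto_const _ this, of "y - ext_sub \<beta> c"] y
  show ?thesis
    unfolding eq by (simp add: mult.commute)
qed

lemma ext_logistic_legendre:
  assumes c: "c > 0" and \<alpha>\<beta>: "\<beta> \<le> 1" "\<beta> \<le> \<alpha>" "\<alpha> \<le> 2" "\<beta> = 1 \<or> \<beta> < \<alpha>"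
  shows "legendre (ext_exp_dom \<beta> c) (ext_logistic \<alpha> \<beta> c)"
proof (rule legendre_open_of_deriv)
  let ?D = "ext_exp_dom \<beta> c" and ?E = "ext_exp \<beta> c" and ?s = "ext_logistic_slope \<alpha> \<beta> c"
  note dom = open_convex_ext_exp_dom[OF \<alpha>\<beta>(1), of c]
  show "open ?D" "convex ?D" "?D \<noteq> {}" by (fact dom)+
  show "(ext_logistic \<alpha> \<beta> c has_real_derivative ?s (?E x)) (at x)" if "x \<in> ?D" for x
    by (rule ext_logistic_deriv[OF c \<alpha>\<beta>(1) that])
  show "?s (?E x) < ?s (?E y)" if "x \<in> ?D" "y \<in> ?D" "x < y" for x y
    using ext_logistic_slope_less[OF c \<alpha>\<beta>(1-3)] ext_exp_less[OF c \<alpha>\<beta>(1) that]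
      ext_exp_pos[OF c \<alpha>\<beta>(1) that(1)] by blast
  have "continuous_on ?D ?E"
    using ext_exp_deriv[OF c \<alpha>\<beta>(1)] DERIV_isCont by (blast intro: continuous_at_imp_continuous_on)
  moreover have "?E x \<noteq> 0 \<and> c + ?E x \<noteq> 0" if "x \<in> ?D" for x
    using ext_exp_pos[OF c \<alpha>\<beta>(1) that] c by simp
  ultimately show "continuous_on ?D (\<lambda>x. ?s (?E x))"
    unfolding ext_logistic_slope_def by (auto intro!: continuous_intros)
  show "filterlim (\<lambda>t. ?s (?E (x + t * (y - x))) * (y - x)) at_bot (at_right 0)"
    if "x \<in> frontier ?D" "y \<in> ?D" for x y
  proof (cases "\<beta> = 1")
    case True
    with that show ?thesis by (simp add: ext_exp_dom_def)
  next
    case False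
    with \<alpha>\<beta> have \<beta>: "\<beta> < 1" "\<beta> < \<alpha>" by auto
    have "x = ext_sub \<beta> c" "y < ext_sub \<beta> c"
      using that by (auto simp: ext_exp_dom_less_1[OF \<beta>(1)] frontier_def interior_open)
    with ext_logistic_steep[OF c \<beta>] show ?thesis by simp
  qed
qed

lemma ext_logistic_analytic:
  assumes c: "c > 0" and \<beta>: "\<beta> \<le> 1"
  shows "real_analytic_on (ext_exp_dom \<beta> c) (ext_logistic \<alpha> \<beta> c)"
  unfolding real_analytic_on_def
proof
  fix \<theta> assume \<theta>: "\<theta> \<in> ext_exp_dom \<beta> c"
  define u where "u z = complex_of_real (c powr (\<beta> - 1)) + of_real (\<beta> - 1) * z" for z
  define E where "E = (if \<beta> = 1 then (\<lambda>z. of_real c * exp z) else (\<lambda>z. u z powr of_real (1 / (\<beta> - 1))))"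
  define L where "L = (if \<alpha> = 1 then (\<lambda>w. ln w - of_real (ln c))
    else (\<lambda>w. of_real (ext_sub \<alpha> c) - w powr of_real (\<alpha> - 1) / complex_of_real (1 - \<alpha>)))"
  have u: "u (of_real y) = of_real (c powr (\<beta> - 1) + (\<beta> - 1) * y)" for y
    by (simp add: u_def)
  have E: "E (of_real y) = of_real (ext_exp \<beta> c y)" if "y \<in> ext_exp_dom \<beta> c" for y
  proof (cases "\<beta> = 1")
    case True
    then show ?thesis by (simp add: E_def ext_exp_def exp_of_real)
  next
    case False
    with \<beta> that have "c powr (\<beta> - 1) + (\<beta> - 1) * y > 0"
      by (simp add: ext_exp_dom_def)
    with False show ?thesis
      by (simp only: E_def ext_exp_def u powr_of_real less_imp_le if_False)
  qed
  have L: "L (of_real x) = of_real (ext_ln \<alpha> c x)" if "x > 0" for x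
  proof (cases "\<alpha> = 1")
    case True
    with that show ?thesis by (simp add: L_def ext_ln_def Ln_of_real)
  next
    case False
    have "complex_of_real x powr of_real (\<alpha> - 1) = of_real (x powr (\<alpha> - 1))"
      using that by (intro powr_of_real) simp
    with False show ?thesis
      unfolding L_def ext_ln_def ext_sub_def[of _ x] by (simp only: if_False of_real_diff of_real_divide)
  qed
  have anE: "E analytic_on {of_real \<theta>}"
  proof (cases "\<beta> = 1")
    case True
    then show ?thesis by (auto simp: E_def intro!: analytic_intros)
  next
    case False
    with \<beta> \<theta> have "c powr (\<beta> - 1) + (\<beta> - 1) * \<theta> > 0"
      by (simp add: ext_exp_dom_def)
    then have "u (of_real \<theta>) \<notin> \<real>\<^sub>\<le>\<^sub>0"
      unfolding u by (simp only: nonpos_Reals_of_real_iff not_le)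
    moreover have "u analytic_on {of_real \<theta>}"
      unfolding u_def by (intro analytic_intros)
    ultimately show ?thesis
      using False by (auto simp: E_def intro!: analytic_intros)
  qed
  have w: "complex_of_real c + E (of_real \<theta>) \<notin> \<real>\<^sub>\<le>\<^sub>0"
    using ext_exp_pos[OF c \<beta> \<theta>] c unfolding E[OF \<theta>] of_real_add[symmetric] nonpos_Reals_of_real_iff
    by simp
  have "(\<lambda>z. L (of_real c + E z)) analytic_on {of_real \<theta>}"
    using anE w unfolding L_def by (cases "\<alpha> = 1") (auto intro!: analytic_intros)
  moreover have "\<forall>\<^sub>F y in nhds \<theta>. L (of_real c + E (of_real y)) = of_real (ext_logistic \<alpha> \<beta> c y)"
    using eventually_nhds_in_open[OF open_convex_ext_exp_dom(1)[OF \<beta>] \<theta>]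
  proof eventually_elim
    case (elim y)
    then have "c + ext_exp \<beta> c y > 0"
      using ext_exp_pos[OF c \<beta>] c by (simp add: add_pos_pos)
    with elim show ?case
      by (simp add: E L ext_logistic_def flip: of_real_add)
  qed
  ultimately show "\<exists>F. (\<lambda>h. ext_logistic \<alpha> \<beta> c (\<theta> + h)) has_fps_expansion F"
    by (rule has_fps_expansion_of_complex_analytic)
qed

section \<open>Exponential dispersion models\<close>

text \<open>The conjugate only rescales the base, so it drops out of the exponent. From here on a base is
  handled through \<open>edm_p1\<close> alone.\<close>

lemma edm_density_eq:
  "edm_density D f p0 \<sigma>2 b \<theta> = edm_p1 D f p0 \<sigma>2 b * exp ((b * \<theta> - f \<theta>) / \<sigma>2)"
  by (simp add: edm_density_def edm_p1_def fenchel_young_def mult.assoc flip: exp_add)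
     (simp add: diff_divide_distrib add_divide_distrib)

lemma conjugate_finite:
  assumes "D \<noteq> {}" and le: "\<And>\<theta>. \<theta> \<in> D \<Longrightarrow> b * \<theta> - f \<theta> \<le> M"
  shows "\<bar>conjugate D f b\<bar> \<noteq> \<infinity>"
proof -
  obtain \<theta> where "\<theta> \<in> D" using assms by auto
  then have "ereal (b * \<theta> - f \<theta>) \<le> conjugate D f b"
    unfolding conjugate_def by (rule SUP_upper)
  moreover have "conjugate D f b \<le> ereal M"
    unfolding conjugate_def by (rule SUP_least) (simp add: le)
  ultimately show ?thesis by (cases "conjugate D f b") auto
qed

text \<open>Any positive weights \<open>w\<close> that normalise the exponential family arise as \<open>edm_p1\<close>: the base
  \<open>w b * exp (f\<^sup>* b)\<close> compensates the conjugate.\<close>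

lemma ex_edm_base:
  assumes "D \<noteq> {}"
    and bound: "\<And>b. b \<in> B \<Longrightarrow> \<exists>M. \<forall>\<theta>\<in>D. b * \<theta> - f \<theta> \<le> M"
    and w: "\<And>b. b \<in> B \<Longrightarrow> w b > 0"
    and total: "\<And>\<theta>. \<theta> \<in> D \<Longrightarrow> (\<integral>\<^sup>+ b\<in>B. ennreal (w b * exp (b * \<theta> - f \<theta>)) \<partial>\<nu>) = 1"
  shows "\<exists>p0. edm_base D f B \<nu> 1 p0"
proof
  let ?p0 = "\<lambda>b. w b * exp (real_of_ereal (conjugate D f b))"
  have dens: "edm_density D f ?p0 1 b \<theta> = w b * exp (b * \<theta> - f \<theta>)" for b \<theta>
    unfolding edm_density_eq by (simp add: edm_p1_def exp_minus)
  have "\<bar>conjugate D f b\<bar> \<noteq> \<infinity>" if b: "b \<in> B" for b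
  proof -
    obtain M where "\<forall>\<theta>\<in>D. b * \<theta> - f \<theta> \<le> M" using bound[OF b] ..
    then show ?thesis by (intro conjugate_finite[OF \<open>D \<noteq> {}\<close>, of b f M]) simp
  qed
  then show "edm_base D f B \<nu> 1 ?p0"
    using w total by (simp add: edm_base_def dens)
qed

lemma edm_p1_pos:
  assumes "edm_base D f B \<nu> \<sigma>2 p0" "b \<in> B"
  shows "edm_p1 D f p0 \<sigma>2 b > 0"
  using assms by (simp add: edm_base_def edm_p1_def)

lemma nn_integral_01:
  assumes "h 0 \<ge> 0" "h 1 \<ge> 0"
  shows "(\<integral>\<^sup>+ b\<in>{0, 1::real}. ennreal (h b) \<partial>count_space UNIV) = ennreal (h 0 + h 1)"
  using assms by (subst nn_integral_indicator_finite) auto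

lemma nn_integral_Nats:
  "(\<integral>\<^sup>+ b\<in>\<nat>. ennreal (h b) \<partial>count_space UNIV) = (\<Sum>n. ennreal (h (real n)))"
proof -
  have "bij_betw real UNIV \<nat>"
    by (simp add: bij_betw_def Nats_def inj_on_def)
  then have "(\<integral>\<^sup>+ n. ennreal (h (real n)) \<partial>count_space UNIV) = (\<integral>\<^sup>+ b. ennreal (h b) \<partial>count_space \<nat>)"
    by (rule nn_integral_bij_count_space)
  then show ?thesis
    by (subst (asm) (2) nn_integral_count_space_indicator) (simp_all add: nn_integral_count_space_nat)
qed

lemma sums_of_suminf_ennreal_eq_1:
  assumes "\<And>n. h n \<ge> 0" and "(\<Sum>n. ennreal (h n)) = 1"
  shows "h sums 1"
proof -
  have "summable h"
    by (rule summable_suminf_not_top) (use assms in auto)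
  with assms show ?thesis
    by (simp add: suminf_ennreal2 sums_iff suminf_nonneg)
qed

section \<open>Bernoulli and Poisson distributions\<close>

lemma ext_logistic_1_1:
  assumes "c > 0"
  shows "ext_logistic 1 1 c \<theta> = ln (1 + exp \<theta>)"
proof -
  have "c + c * exp \<theta> = c * (1 + exp \<theta>)" by (simp add: algebra_simps)
  moreover have "1 + exp \<theta> > 0" by (simp add: add_pos_pos)
  ultimately show ?thesis
    using assms by (simp add: ext_logistic_def ext_ln_def ext_exp_def ln_mult)
qed

lemma ext_logistic_2_1: "ext_logistic 2 1 1 \<theta> = exp \<theta>"
  by (simp add: ext_logistic_def ext_ln_def ext_exp_def ext_sub_def)

lemma ex_edm_base_bernoulli:
  "\<exists>p0. edm_base UNIV (\<lambda>\<theta>. ln (1 + exp \<theta>)) {0, 1} (count_space UNIV) 1 p0"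
proof (rule ex_edm_base[where w = "\<lambda>_. 1"])
  fix b :: real assume b: "b \<in> {0, 1}"
  have "b * \<theta> - ln (1 + exp \<theta>) \<le> 0" for \<theta>
  proof -
    have "ln (exp \<theta>) \<le> ln (1 + exp \<theta>)" "0 \<le> ln (1 + exp \<theta>)"
      by (auto simp del: ln_exp intro!: ln_mono add_pos_pos)
    with b show ?thesis by auto
  qed
  then show "\<exists>M. \<forall>\<theta>\<in>UNIV. b * \<theta> - ln (1 + exp \<theta>) \<le> M" by blast
next
  fix \<theta> :: real
  have "1 + exp \<theta> > 0" by (simp add: add_pos_pos)
  then show "(\<integral>\<^sup>+ b\<in>{0, 1}. ennreal (1 * exp (b * \<theta> - ln (1 + exp \<theta>))) \<partial>count_space UNIV) = 1"
    by (subst nn_integral_01) (auto simp: exp_diff exp_minus field_simps simp flip: add_divide_distrib)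
qed auto

lemma edm_base_bernoulli:
  assumes \<sigma>: "\<sigma>2 > 0" and base: "edm_base UNIV (\<lambda>\<theta>. ln (1 + exp \<theta>)) {0, 1} (count_space UNIV) \<sigma>2 p0"
    and b: "b \<in> {0, 1}"
  shows "edm_density UNIV (\<lambda>\<theta>. ln (1 + exp \<theta>)) p0 \<sigma>2 b \<theta>
           = pmf (map_pmf of_bool (bernoulli_pmf (exp \<theta> / (1 + exp \<theta>)))) b"
proof -
  let ?p = "edm_p1 UNIV (\<lambda>\<theta>. ln (1 + exp \<theta>)) p0 \<sigma>2"
  have pos: "?p 0 > 0" "?p 1 > 0"
    using edm_p1_pos[OF base] by auto
  have "?p 0 * exp (- ln (1 + exp \<theta>) / \<sigma>2) + ?p 1 * exp ((\<theta> - ln (1 + exp \<theta>)) / \<sigma>2) = 1" for \<theta>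
  proof -
    have "(\<integral>\<^sup>+ b\<in>{0, 1}. ennreal (?p b * exp ((b * \<theta> - ln (1 + exp \<theta>)) / \<sigma>2)) \<partial>count_space UNIV) = 1"
      using base unfolding edm_base_def edm_density_eq by blast
    then show ?thesis
      using pos by (subst (asm) nn_integral_01) (auto simp: ennreal_eq_1 simp del: ennreal_plus)
  qed
  from bernoulli_weights_unique[OF \<sigma> this] have eqs: "\<sigma>2 = 1" "?p 0 = 1" "?p 1 = 1"
    by auto
  have e: "1 + exp \<theta> > 0" by (simp add: add_pos_pos)
  have inj: "inj (of_bool :: bool \<Rightarrow> real)"
    by (auto simp: inj_def)
  have "pmf (map_pmf of_bool (bernoulli_pmf (exp \<theta> / (1 + exp \<theta>)))) (of_bool t :: real)
      = pmf (bernoulli_pmf (exp \<theta> / (1 + exp \<theta>))) t" for t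
    by (rule pmf_map_inj'[OF inj])
  from this[of False] this[of True] b eqs e show ?thesis
    unfolding edm_density_eq by (auto simp: exp_diff exp_minus field_simps)
qed

text \<open>The weights are \<open>1 / b!\<close>. The conjugate is finite at \<open>b > 0\<close> because \<open>exp\<close> lies above its
  tangent at \<open>ln b\<close>.\<close>

lemma ex_edm_base_poisson: "\<exists>p0. edm_base UNIV exp \<nat> (count_space UNIV) 1 p0"
proof (rule ex_edm_base[where w = "\<lambda>b. 1 / fact (nat \<lfloor>b\<rfloor>)"])
  fix b :: real assume "b \<in> \<nat>"
  show "\<exists>M. \<forall>\<theta>\<in>UNIV. b * \<theta> - exp \<theta> \<le> M"
  proof (cases "b = 0")
    case False
    with \<open>b \<in> \<nat>\<close> have b: "b > 0" by (auto simp: Nats_def)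
    have "b * \<theta> - exp \<theta> \<le> b * ln b - b" for \<theta>
    proof -
      have "b * (1 + (\<theta> - ln b)) \<le> b * exp (\<theta> - ln b)"
        using b by (intro mult_left_mono exp_ge_add_one_self) auto
      also have "\<dots> = exp \<theta>" using b by (simp add: exp_diff)
      finally show ?thesis by (simp add: algebra_simps)
    qed
    then show ?thesis by blast
  qed (auto intro!: exI[of _ 0])
next
  fix \<theta> :: real
  have "(\<Sum>n. ennreal (1 / fact n * exp (real n * \<theta> - exp \<theta>)))
      = (\<integral>\<^sup>+ n. ennreal (pmf (poisson_pmf (exp \<theta>)) n) \<partial>count_space UNIV)"
    by (subst nn_integral_count_space_nat)
       (simp add: exp_diff exp_minus divide_inverse mult_ac flip: exp_of_nat_mult)
  also have "\<dots> = 1" by (rule nn_integral_pmf_eq_1)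
  finally show "(\<integral>\<^sup>+ b\<in>\<nat>. ennreal (1 / fact (nat \<lfloor>b\<rfloor>) * exp (b * \<theta> - exp \<theta>)) \<partial>count_space UNIV) = 1"
    by (subst nn_integral_Nats) simp
qed auto

lemma edm_base_poisson:
  assumes \<sigma>: "\<sigma>2 > 0" and base: "edm_base UNIV exp \<nat> (count_space UNIV) \<sigma>2 p0" and b: "b \<in> \<nat>"
  shows "edm_density UNIV exp p0 \<sigma>2 b \<theta> = pmf (map_pmf real (poisson_pmf (exp \<theta>))) b"
proof -
  let ?p = "edm_p1 UNIV exp p0 \<sigma>2"
  have pos: "?p (real n) > 0" for n
    using edm_p1_pos[OF base] by auto
  have "(\<lambda>n. ?p (real n) * x ^ n) sums exp (x powr \<sigma>2 / \<sigma>2)" if "x > 0" for x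
  proof -
    \<comment> \<open>This choice gives \<open>x = exp (\<theta> / \<sigma>2)\<close>, so the normalisation at \<open>\<theta>\<close> is a power series in \<open>x\<close>.\<close>
    define \<theta> where "\<theta> = \<sigma>2 * ln x"
    have "exp \<theta> = x powr \<sigma>2"
      using that by (simp add: \<theta>_def powr_def)
    moreover have "exp (real n * \<theta> / \<sigma>2) = x ^ n" for n
      using that \<sigma> by (simp add: \<theta>_def exp_of_nat_mult)
    ultimately have eq: "exp ((real n * \<theta> - exp \<theta>) / \<sigma>2) = x ^ n * exp (- (x powr \<sigma>2 / \<sigma>2))" for n
      by (simp add: diff_divide_distrib exp_diff) (simp add: exp_minus field_simps)
    have "(\<integral>\<^sup>+ b\<in>\<nat>. ennreal (?p b * exp ((b * \<theta> - exp \<theta>) / \<sigma>2)) \<partial>count_space UNIV) = 1"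
      using base unfolding edm_base_def edm_density_eq by blast
    then have "(\<Sum>n. ennreal (?p (real n) * exp ((real n * \<theta> - exp \<theta>) / \<sigma>2))) = 1"
      by (simp only: nn_integral_Nats)
    from sums_of_suminf_ennreal_eq_1[OF _ this] pos
    have "(\<lambda>n. ?p (real n) * exp ((real n * \<theta> - exp \<theta>) / \<sigma>2)) sums 1"
      by (simp add: less_imp_le)
    from sums_mult2[OF this, of "exp (x powr \<sigma>2 / \<sigma>2)"] show ?thesis
      unfolding eq by (simp add: exp_minus mult.assoc)
  qed
  moreover have "?p (real 1) \<noteq> 0"
    using pos[of 1] by simp
  ultimately have eqs: "\<sigma>2 = 1 \<and> ?p (real n) = 1 / fact n" for n
    by (intro poisson_weights_unique[OF \<sigma>, of "\<lambda>n. ?p (real n)"])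
  obtain n where n: "b = real n" using b by (auto simp: Nats_def)
  have \<sigma>1: "\<sigma>2 = 1" and p: "edm_p1 UNIV exp p0 1 (real n) = 1 / fact n"
    using eqs[of n] by auto
  have "pmf (map_pmf real (poisson_pmf (exp \<theta>))) (real n) = pmf (poisson_pmf (exp \<theta>)) n"
    by (rule pmf_map_inj') (simp add: inj_def)
  then show ?thesis
    unfolding edm_density_eq n \<sigma>1 p
    by (simp add: exp_diff exp_minus divide_inverse mult_ac flip: exp_of_nat_mult)
qed

section \<open>The Legendre property, analyticity and the two densities\<close>

theorem mainTheorem6:
  fixes \<alpha> \<beta> c :: real
  assumes "c > 0"
  shows "(\<alpha> = 1 \<and> \<beta> = 1 \<longrightarrow>
            ext_exp_dom \<beta> c = UNIV \<and>
            legendre (ext_exp_dom \<beta> c) (ext_logistic \<alpha> \<beta> c) \<and>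
            real_analytic_on (ext_exp_dom \<beta> c) (ext_logistic \<alpha> \<beta> c))
       \<and> (\<alpha> = 2 \<and> \<beta> = 1 \<longrightarrow>
            ext_exp_dom \<beta> c = UNIV \<and>
            legendre (ext_exp_dom \<beta> c) (ext_logistic \<alpha> \<beta> c) \<and>
            real_analytic_on (ext_exp_dom \<beta> c) (ext_logistic \<alpha> \<beta> c))
       \<and> (\<beta> < \<alpha> \<and> \<alpha> \<le> 2 \<and> \<beta> < 1 \<longrightarrow>
            ext_exp_dom \<beta> c = {\<theta>. \<theta> < ext_sub \<beta> c} \<and>
            legendre (ext_exp_dom \<beta> c) (ext_logistic \<alpha> \<beta> c) \<and>
            real_analytic_on (ext_exp_dom \<beta> c) (ext_logistic \<alpha> \<beta> c))
       \<and> (\<alpha> = 1 \<and> \<beta> = 1 \<longrightarrow>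
            (\<exists>p0. edm_base (ext_exp_dom \<beta> c) (ext_logistic \<alpha> \<beta> c) {0, 1} (count_space UNIV) 1 p0) \<and>
            (\<forall>\<sigma>2 > 0. \<forall>p0.
               edm_base (ext_exp_dom \<beta> c) (ext_logistic \<alpha> \<beta> c) {0, 1} (count_space UNIV) \<sigma>2 p0 \<longrightarrow>
               (\<forall>\<theta> \<in> ext_exp_dom \<beta> c. \<forall>b \<in> {0, 1}.
                  edm_density (ext_exp_dom \<beta> c) (ext_logistic \<alpha> \<beta> c) p0 \<sigma>2 b \<theta>
                    = edm_p1 (ext_exp_dom \<beta> c) (ext_logistic \<alpha> \<beta> c) p0 \<sigma>2 b
                      * exp ((b * \<theta> - ext_logistic \<alpha> \<beta> c \<theta>) / \<sigma>2) \<and>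
                  edm_density (ext_exp_dom \<beta> c) (ext_logistic \<alpha> \<beta> c) p0 \<sigma>2 b \<theta>
                    = pmf (map_pmf of_bool (bernoulli_pmf (exp \<theta> / (1 + exp \<theta>)))) b)))
       \<and> (\<alpha> = 2 \<and> \<beta> = 1 \<and> c = 1 \<longrightarrow>
            (\<exists>p0. edm_base (ext_exp_dom \<beta> c) (ext_logistic \<alpha> \<beta> c) \<nat> (count_space UNIV) 1 p0) \<and>
            (\<forall>\<sigma>2 > 0. \<forall>p0.
               edm_base (ext_exp_dom \<beta> c) (ext_logistic \<alpha> \<beta> c) \<nat> (count_space UNIV) \<sigma>2 p0 \<longrightarrow>
               (\<forall>\<theta> \<in> ext_exp_dom \<beta> c. \<forall>b \<in> \<nat>.
                  edm_density (ext_exp_dom \<beta> c) (ext_logistic \<alpha> \<beta> c) p0 \<sigma>2 b \<theta>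
                    = edm_p1 (ext_exp_dom \<beta> c) (ext_logistic \<alpha> \<beta> c) p0 \<sigma>2 b
                      * exp ((b * \<theta> - ext_logistic \<alpha> \<beta> c \<theta>) / \<sigma>2) \<and>
                  edm_density (ext_exp_dom \<beta> c) (ext_logistic \<alpha> \<beta> c) p0 \<sigma>2 b \<theta>
                    = pmf (map_pmf real (poisson_pmf (exp \<theta>))) b)))"
proof -
  have dom: "ext_exp_dom 1 c = UNIV"
    by (simp add: ext_exp_dom_def)
  note legendre = ext_logistic_legendre[OF assms] and analytic = ext_logistic_analytic[OF assms]
  have f11: "ext_logistic 1 1 c = (\<lambda>\<theta>. ln (1 + exp \<theta>))"
    by (simp add: fun_eq_iff ext_logistic_1_1[OF assms])
  have f21: "ext_logistic 2 1 1 = exp"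
    by (simp add: fun_eq_iff ext_logistic_2_1)
  have "ext_exp_dom \<beta> c = UNIV \<and> legendre (ext_exp_dom \<beta> c) (ext_logistic \<alpha> \<beta> c) \<and>
      real_analytic_on (ext_exp_dom \<beta> c) (ext_logistic \<alpha> \<beta> c)"
    if "\<alpha> = 1 \<or> \<alpha> = 2" "\<beta> = 1"
    using that dom legendre[of \<beta> \<alpha>] analytic[of \<beta> \<alpha>] by auto
  moreover have "ext_exp_dom \<beta> c = {\<theta>. \<theta> < ext_sub \<beta> c} \<and>
      legendre (ext_exp_dom \<beta> c) (ext_logistic \<alpha> \<beta> c) \<and>
      real_analytic_on (ext_exp_dom \<beta> c) (ext_logistic \<alpha> \<beta> c)"
    if "\<beta> < \<alpha>" "\<alpha> \<le> 2" "\<beta> < 1"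
    using that legendre[of \<beta> \<alpha>] analytic[of \<beta> \<alpha>] ext_exp_dom_less_1[of \<beta> c]
    by (auto simp: lessThan_def)
  ultimately show ?thesis
    using dom f11 f21 ex_edm_base_bernoulli edm_base_bernoulli ex_edm_base_poisson edm_base_poisson
    by (auto simp: edm_density_eq)
qed

end
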